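(* Let $\mathcal P_1$ and $\mathcal P_2$ be two finite posets, and let $\mathcal Q$ be a finite poset with the unique cover twin property (UCTP) and at least two elements. Then $\text{sat}^*(n,\mathcal P_1*\mathcal Q*\mathcal P_2)\rightarrow\infty$ as $n\rightarrow\infty$.
   Context: $[n]=\{1,\dots,n\}$, and families of subsets of $[n]$ are ordered by inclusion. A poset $(\mathcal Q,\preceq)$ contains an induced copy of a poset $(\mathcal P,\preceq')$ if there is an injective order-preserving function $f:\mathcal P\to\mathcal Q$ such that $(f(\mathcal P),\preceq)$ is isomorphic to $(\mathcal P,\preceq')$. For a finite poset $\mathcal P$, a family $\mathcal F$ of subsets of $[n]$ is $\mathcal P$-saturated if $\mathcal F$ contains no induced copy of $\mathcal P$ and, for every subset $S\subseteq[n]$ with $S\notin\mathcal F$, the family $\mathcal F\cup\{S\}$ contains an induced copy of $\mathcal P$. The induced saturation number $\text{sat}^*(n,\mathcal P)$ is the smallest size of a $\mathcal P$-saturated family of subsets of $[n]$. For finite posets $\mathcal Q_1,\mathcal Q_2$, the linear sum $\mathcal Q_1*\mathcal Q_2$ is the poset consisting of an induced copy of $\mathcal Q_1$ placed completely above an induced copy of $\mathcal Q_2$, i.e. every element of $\mathcal Q_1$ is strictly greater than every element of $\mathcal Q_2$; if one of the two posets is empty, $\mathcal Q_1*\mathcal Q_2$ is the other one. This operation is associative. In a poset, $y$ covers $x$ if $x<y$ and there is no $z$ with $x<z<y$. A poset has the UCTP if, for any two elements $p_1,p_2$ such that $p_2$ covers $p_1$, there exists an element $p_3$ of the poset that is comparable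 with exactly one of $p_1$ and $p_2$. *)

theory Defs
  imports Complex_Main
begin

text \<open>
  A poset is given by its reflexive order relation \<open>r\<close> with \<open>Partial_order r\<close>; its set of
  elements is \<open>Field r\<close>. In particular, the empty poset is \<open>{}\<close>.
\<close>

text \<open>
  \<^const>\<open>iso\<close> is defined through initial segments; by \<open>iso_iff2\<close> it is the usual notion of order
  isomorphism for arbitrary relations.
\<close>

definition poset_isomorphic :: "'a rel \<Rightarrow> 'b rel \<Rightarrow> bool" where
  "poset_isomorphic r s \<longleftrightarrow> (\<exists>g. iso r s g)"

definition has_induced_copy :: "'b rel \<Rightarrow> 'a rel \<Rightarrow> bool" where
  "has_induced_copy s r \<longleftrightarrow>
     (\<exists>f. f ` Field r \<subseteq> Field s \<and> inj_on f (Field r) \<and>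
          (\<forall>x y. (x, y) \<in> r \<longrightarrow> (f x, f y) \<in> s) \<and>
          poset_isomorphic (Restr s (f ` Field r)) r)"

definition incl_poset :: "'a set set \<Rightarrow> 'a set rel" where
  "incl_poset F = relation_of (\<subseteq>) F"

definition saturated :: "nat \<Rightarrow> 'a rel \<Rightarrow> nat set set \<Rightarrow> bool" where
  "saturated n r F \<longleftrightarrow>
     F \<subseteq> Pow {1..n} \<and>
     \<not> has_induced_copy (incl_poset F) r \<and>
     (\<forall>S. S \<subseteq> {1..n} \<and> S \<notin> F \<longrightarrow> has_induced_copy (incl_poset (F \<union> {S})) r)"

text \<open>
  Every nonempty finite poset has a saturated family, so the minimum exists; for the empty poset
  no family is saturated and the value is irrelevant.
\<close>

definition sat_star :: "nat \<Rightarrow> 'a rel \<Rightarrow> nat" where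
  "sat_star n r = (LEAST k. \<exists>F. saturated n r F \<and> card F = k)"

text \<open>The first argument is placed above the second.\<close>

definition linear_sum :: "'a rel \<Rightarrow> 'b rel \<Rightarrow> ('a + 'b) rel" where
  "linear_sum r s =
     {(Inl x, Inl y) | x y. (x, y) \<in> r} \<union>
     {(Inr x, Inr y) | x y. (x, y) \<in> s} \<union>
     {(Inr y, Inl x) | x y. x \<in> Field r \<and> y \<in> Field s}"

definition covers :: "'a rel \<Rightarrow> 'a \<Rightarrow> 'a \<Rightarrow> bool" where
  "covers r y x \<longleftrightarrow>
     (x, y) \<in> r \<and> x \<noteq> y \<and>
     \<not> (\<exists>z. (x, z) \<in> r \<and> x \<noteq> z \<and> (z, y) \<in> r \<and> z \<noteq> y)"

text \<open>
  Comparability is reflexive, so the two elements of a covering pair are each comparable with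
  both, and neither can serve as the element \<open>p3\<close> in \<open>UCTP\<close>.
\<close>

definition comparable :: "'a rel \<Rightarrow> 'a \<Rightarrow> 'a \<Rightarrow> bool" where
  "comparable r x y \<longleftrightarrow> (x, y) \<in> r \<or> (y, x) \<in> r"

definition UCTP :: "'a rel \<Rightarrow> bool" where
  "UCTP r \<longleftrightarrow>
     (\<forall>p1 \<in> Field r. \<forall>p2 \<in> Field r. covers r p2 p1 \<longrightarrow>
        (\<exists>p3 \<in> Field r. comparable r p3 p1 \<noteq> comparable r p3 p2))"

end

theory Submission
  imports Defs
begin

text \<open>
  A saturated family \<open>F\<close> on \<open>{1..n}\<close> satisfies \<open>n \<le> 2 ^ card F\<close>, which is more than the theorem asks
  for. If \<open>n\<close> is larger, two points \<open>i \<noteq> j\<close> lie in exactly the same members of \<open>F\<close>. A set that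
  contains just one of them is then never in \<open>F\<close>, so adding it creates a copy of \<open>P1 * Q * P2\<close>; a
  contradiction follows in two rounds. A copy of the linear sum is handled as a \<^emph>\<open>stack\<close> of three layers:
  \<open>C1\<close> (a copy of \<open>P1\<close>) above \<open>D\<close> (a copy of \<open>Q\<close>) above \<open>C2\<close> (a copy of \<open>P2\<close>).

  \<^emph>\<open>Some set \<open>S\<close> containing \<open>j\<close> but not \<open>i\<close> can take part in the middle layer.\<close> Otherwise each such
  set lies below a stack \<open>C1, D\<close> in \<open>F\<close>, or above a stack \<open>D, C2\<close> in \<open>F\<close>. The set \<open>{j}\<close> is of the
  first kind. Let \<open>S\<close> be a maximal set of the first kind, below \<open>D\<close> and \<open>C1\<close>. Every member of \<open>D\<close>
  contains \<open>j\<close>, hence \<open>i\<close>; as \<open>D\<close> has two members, one of them, \<open>X\<close>, is larger than \<open>insert i S\<close>. Then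
  \<open>X - {i}\<close> is of the second kind, and its stack fits under \<open>X\<close> and so under \<open>C1\<close>: there is a full stack
  in \<open>F\<close>.

  \<^emph>\<open>Exchanging \<open>S\<close> for a neighbour.\<close> Another member \<open>X\<close> of that middle layer belongs to \<open>F\<close> and lies
  between copies \<open>C1\<close> and \<open>C2\<close> in \<open>F\<close> such that all of \<open>C1\<close>, but nothing of \<open>C2\<close>, contains \<open>i\<close>. If
  \<open>i \<notin> X\<close>, take \<open>X\<close> maximal with these properties and add \<open>S = insert i X\<close>. As \<open>S\<close> lies between \<open>C1\<close> and
  \<open>C2\<close>, it is again in the middle layer of the new stack; by maximality, \<open>S\<close> and \<open>X\<close> compare in the
  same way with the rest of that layer. If the layer does not use \<open>X\<close>, then \<open>X\<close> can replace \<open>S\<close>, which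
  gives a stack in \<open>F\<close>. If it does, then \<open>S\<close> covers \<open>X\<close> in a copy of \<open>Q\<close> and nothing tells them apart,
  against the UCTP. The case \<open>i \<in> X\<close> is the order dual, with \<open>S = X - {i}\<close>. Both cases are instances
  of \<open>no_stack_around_unmarked\<close>, and \<open>saturated_stack_separates\<close> combines the two rounds.
\<close>

section \<open>Induced copies\<close>

text \<open>
  The order \<open>le\<close> is a parameter so that one argument serves both for inclusion and for its reverse.
\<close>

definition copy_on :: "('x \<Rightarrow> 'x \<Rightarrow> bool) \<Rightarrow> 'p rel \<Rightarrow> 'x set \<Rightarrow> bool" where
  "copy_on le r A \<longleftrightarrow>
     (\<exists>f. bij_betw f (Field r) A \<and>
          (\<forall>x\<in>Field r. \<forall>y\<in>Field r. (x, y) \<in> r \<longleftrightarrow> le (f x) (f y)))"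

definition all_below :: "('x \<Rightarrow> 'x \<Rightarrow> bool) \<Rightarrow> 'x set \<Rightarrow> 'x set \<Rightarrow> bool" where
  "all_below le A B \<longleftrightarrow> (\<forall>a\<in>A. \<forall>b\<in>B. le a b \<and> a \<noteq> b)"

text \<open>
  That \<open>C2\<close> lies below \<open>C1\<close> is left out: it follows by transitivity through \<open>D\<close> as soon as \<open>Q\<close> is
  nonempty.
\<close>

definition stacked ::
  "('x \<Rightarrow> 'x \<Rightarrow> bool) \<Rightarrow> 'a rel \<Rightarrow> 'b rel \<Rightarrow> 'c rel \<Rightarrow> 'x set \<Rightarrow> 'x set \<Rightarrow> 'x set \<Rightarrow> bool" where
  "stacked le P1 Q P2 C1 D C2 \<longleftrightarrow>
     copy_on le P1 C1 \<and> copy_on le Q D \<and> copy_on le P2 C2 \<and>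
     all_below le C2 D \<and> all_below le D C1"

definition has_stack ::
  "('x \<Rightarrow> 'x \<Rightarrow> bool) \<Rightarrow> 'a rel \<Rightarrow> 'b rel \<Rightarrow> 'c rel \<Rightarrow> 'x set \<Rightarrow> bool" where
  "has_stack le P1 Q P2 F \<longleftrightarrow>
     (\<exists>C1 D C2. C1 \<subseteq> F \<and> D \<subseteq> F \<and> C2 \<subseteq> F \<and> stacked le P1 Q P2 C1 D C2)"

lemma all_belowD:
  assumes "all_below le A B" "a \<in> A" "b \<in> B"
  shows "le a b" and "a \<noteq> b"
  using assms unfolding all_below_def by blast+

lemma all_below_mono:
  "all_below le A B \<Longrightarrow> A' \<subseteq> A \<Longrightarrow> B' \<subseteq> B \<Longrightarrow> all_below le A' B'"
  unfolding all_below_def by blast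

lemma all_below_Un_right:
  "all_below le A (B \<union> C) \<longleftrightarrow> all_below le A B \<and> all_below le A C"
  unfolding all_below_def by blast

lemma all_below_trans:
  assumes "transp le" "antisymp le" "all_below le A B" "all_below le B C" "b \<in> B"
  shows "all_below le A C"
  unfolding all_below_def
proof (intro ballI)
  fix a c assume "a \<in> A" "c \<in> C"
  then have "le a b" "a \<noteq> b" "le b c"
    using assms unfolding all_below_def by blast+
  then show "le a c \<and> a \<noteq> c"
    using assms(1,2) by (metis antisympD transpD)
qed

lemma has_stackI:
  assumes "copy_on le P1 C1" "copy_on le Q D" "copy_on le P2 C2"
    and "all_below le C2 D" "all_below le D C1"
    and "C1 \<subseteq> F" "D \<subseteq> F" "C2 \<subseteq> F"
  shows "has_stack le P1 Q P2 F"
  using assms unfolding has_stack_def stacked_def by blast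

lemma copy_on_card: "copy_on le r A \<Longrightarrow> card A = card (Field r)"
  unfolding copy_on_def by (metis bij_betw_same_card)

lemma copy_on_converse: "copy_on (\<lambda>x y. le y x) (r\<inverse>) A \<longleftrightarrow> copy_on le r A"
  unfolding copy_on_def Field_converse converse_iff
  by (intro ex_cong1 conj_cong refl) blast

lemma all_below_converse: "all_below (\<lambda>x y. le y x) A B \<longleftrightarrow> all_below le B A"
  unfolding all_below_def by blast

text \<open>Reversing the order turns a stack upside down, so \<open>P1\<close> and \<open>P2\<close> change places.\<close>

lemma has_stack_converse:
  "has_stack (\<lambda>x y. le y x) (P2\<inverse>) (Q\<inverse>) (P1\<inverse>) F \<longleftrightarrow> has_stack le P1 Q P2 F"
  unfolding has_stack_def stacked_def all_below_converse[of le] copy_on_converse[of le]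
  by (rule iffI; elim exE conjE; intro exI conjI; assumption)

lemma UCTP_converse: "UCTP (r\<inverse>) \<longleftrightarrow> UCTP r"
proof -
  have covers: "covers (r\<inverse>) y x \<longleftrightarrow> covers r x y" for x y
    unfolding covers_def converse_iff by metis
  have comparable: "comparable (r\<inverse>) x y \<longleftrightarrow> comparable r x y" for x y
    unfolding comparable_def converse_iff by (rule disj_commute)
  show ?thesis
    unfolding UCTP_def Field_converse covers comparable by metis
qed

lemma copy_on_replace:
  assumes "reflp le" and "copy_on le r D" and "S \<in> D" and "X \<notin> D"
    and twin: "\<And>Z. Z \<in> D - {S} \<Longrightarrow> (le Z S \<longleftrightarrow> le Z X) \<and> (le S Z \<longleftrightarrow> le X Z)"
  shows "copy_on le r (insert X (D - {S}))"
proof -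
  obtain f where f: "bij_betw f (Field r) D"
    and iso: "\<And>x y. x \<in> Field r \<Longrightarrow> y \<in> Field r \<Longrightarrow> (x, y) \<in> r \<longleftrightarrow> le (f x) (f y)"
    using assms(2) unfolding copy_on_def by blast
  define g where "g = (\<lambda>Z. if Z = S then X else Z)"
  have g: "bij_betw g D (insert X (D - {S}))"
    using \<open>S \<in> D\<close> \<open>X \<notin> D\<close> unfolding bij_betw_def inj_on_def g_def by auto
  have le: "le (g Y) (g Z) \<longleftrightarrow> le Y Z" if "Y \<in> D" "Z \<in> D" for Y Z
    using that twin \<open>reflp le\<close> unfolding g_def by (auto dest: reflpD)
  have "(x, y) \<in> r \<longleftrightarrow> le ((g \<circ> f) x) ((g \<circ> f) y)" if "x \<in> Field r" "y \<in> Field r" for x y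
    using that iso le f by (simp add: bij_betw_apply)
  then show ?thesis
    using bij_betw_trans[OF f g] unfolding copy_on_def by blast
qed

text \<open>
  If nothing in the copy lies between \<open>X\<close> and \<open>S\<close>, their preimages form a covering pair, and the
  element that tells that pair apart is transported to the copy.
\<close>

lemma copy_on_UCTP:
  assumes "UCTP Q" and "copy_on le Q D" and "X \<in> D" "S \<in> D" "le X S" "X \<noteq> S"
    and no_between: "\<And>Z. Z \<in> D \<Longrightarrow> le X Z \<Longrightarrow> le Z S \<Longrightarrow> Z = X \<or> Z = S"
  obtains Z where "Z \<in> D" "(le Z X \<or> le X Z) \<noteq> (le Z S \<or> le S Z)"
proof -
  obtain f where f: "bij_betw f (Field Q) D"
    and iso: "\<And>x y. x \<in> Field Q \<Longrightarrow> y \<in> Field Q \<Longrightarrow> (x, y) \<in> Q \<longleftrightarrow> le (f x) (f y)"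
    using assms(2) unfolding copy_on_def by blast
  obtain x s where x: "x \<in> Field Q" "f x = X" and s: "s \<in> Field Q" "f s = S"
    using f \<open>X \<in> D\<close> \<open>S \<in> D\<close> unfolding bij_betw_def by blast
  have "covers Q s x"
    unfolding covers_def
  proof (intro conjI notI)
    show "(x, s) \<in> Q" using iso x s \<open>le X S\<close> by simp
    show "x = s \<Longrightarrow> False" using x s \<open>X \<noteq> S\<close> by simp
    assume "\<exists>z. (x, z) \<in> Q \<and> x \<noteq> z \<and> (z, s) \<in> Q \<and> z \<noteq> s"
    then obtain z where z: "(x, z) \<in> Q" "x \<noteq> z" "(z, s) \<in> Q" "z \<noteq> s" by blast
    then have zQ: "z \<in> Field Q" by (meson FieldI1)
    have "f z = X \<or> f z = S"
      using no_between[of "f z"] f z zQ iso x s by (metis bij_betw_apply)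
    then show False
      using f zQ x s z unfolding bij_betw_def inj_on_def by metis
  qed
  then obtain z where "z \<in> Field Q" "comparable Q z x \<noteq> comparable Q z s"
    using \<open>UCTP Q\<close> x s unfolding UCTP_def by blast
  then show thesis
    using that[of "f z"] f iso x s unfolding comparable_def by (auto simp: bij_betw_apply)
qed

section \<open>Stacks and linear sums\<close>

lemma Field_linear_sum: "Field (linear_sum r s) = Inl ` Field r \<union> Inr ` Field s"
  unfolding linear_sum_def Field_def by (auto simp: Domain_iff Range_iff)

lemma in_linear_sum:
  "(Inl x, Inl y) \<in> linear_sum r s \<longleftrightarrow> (x, y) \<in> r"
  "(Inr u, Inr v) \<in> linear_sum r s \<longleftrightarrow> (u, v) \<in> s"
  "(Inr u, Inl x) \<in> linear_sum r s \<longleftrightarrow> x \<in> Field r \<and> u \<in> Field s"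
  "(Inl x, Inr u) \<notin> linear_sum r s"
  unfolding linear_sum_def by auto

text \<open>
  Antisymmetry is what makes the copy induced: it excludes that an element of the upper part is also
  below an element of the lower part.
\<close>

lemma copy_on_linear_sum:
  assumes "antisymp le"
  shows "copy_on le (linear_sum r s) A \<longleftrightarrow>
    (\<exists>B C. A = B \<union> C \<and> copy_on le r B \<and> copy_on le s C \<and> all_below le C B)"
proof
  assume "copy_on le (linear_sum r s) A"
  then obtain f where f: "bij_betw f (Field (linear_sum r s)) A"
    and iso: "\<And>x y. x \<in> Field (linear_sum r s) \<Longrightarrow> y \<in> Field (linear_sum r s) \<Longrightarrow>
                (x, y) \<in> linear_sum r s \<longleftrightarrow> le (f x) (f y)"
    unfolding copy_on_def by blast
  have inj: "inj_on f (Inl ` Field r \<union> Inr ` Field s)"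
    and A: "A = f ` (Inl ` Field r \<union> Inr ` Field s)"
    using f unfolding bij_betw_def Field_linear_sum by auto
  let ?B = "f ` Inl ` Field r" and ?C = "f ` Inr ` Field s"
  have "bij_betw (f \<circ> Inl) (Field r) ?B" "bij_betw (f \<circ> Inr) (Field s) ?C"
    unfolding bij_betw_def image_comp by (auto intro!: comp_inj_on inj_on_subset[OF inj])
  moreover have "\<forall>x\<in>Field r. \<forall>y\<in>Field r. (x, y) \<in> r \<longleftrightarrow> le ((f \<circ> Inl) x) ((f \<circ> Inl) y)"
    by (simp add: iso[symmetric] Field_linear_sum in_linear_sum)
  moreover have "\<forall>x\<in>Field s. \<forall>y\<in>Field s. (x, y) \<in> s \<longleftrightarrow> le ((f \<circ> Inr) x) ((f \<circ> Inr) y)"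
    by (simp add: iso[symmetric] Field_linear_sum in_linear_sum)
  moreover have "all_below le ?C ?B"
    unfolding all_below_def
  proof (intro ballI)
    fix c b assume "c \<in> ?C" "b \<in> ?B"
    then obtain x y where x: "x \<in> Field r" "b = f (Inl x)" and y: "y \<in> Field s" "c = f (Inr y)"
      by blast
    then show "le c b \<and> c \<noteq> b"
      using iso[of "Inr y" "Inl x"] inj_onD[OF inj, of "Inr y" "Inl x"]
      by (auto simp: Field_linear_sum in_linear_sum)
  qed
  ultimately show "\<exists>B C. A = B \<union> C \<and> copy_on le r B \<and> copy_on le s C \<and> all_below le C B"
    unfolding copy_on_def A image_Un by blast
next
  assume "\<exists>B C. A = B \<union> C \<and> copy_on le r B \<and> copy_on le s C \<and> all_below le C B"
  then obtain B C f g where A: "A = B \<union> C" and below: "all_below le C B"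
    and f: "bij_betw f (Field r) B"
    and fr: "\<forall>x\<in>Field r. \<forall>y\<in>Field r. (x, y) \<in> r \<longleftrightarrow> le (f x) (f y)"
    and g: "bij_betw g (Field s) C"
    and gs: "\<forall>x\<in>Field s. \<forall>y\<in>Field s. (x, y) \<in> s \<longleftrightarrow> le (g x) (g y)"
    unfolding copy_on_def by blast
  define h where "h = case_sum f g"
  have lt: "le (g y) (f x) \<and> g y \<noteq> f x" if "x \<in> Field r" "y \<in> Field s" for x y
    using below f g that unfolding all_below_def by (metis bij_betw_apply)
  have nle: "\<not> le (f x) (g y)" if "x \<in> Field r" "y \<in> Field s" for x y
    using lt[OF that] \<open>antisymp le\<close> by (metis antisympD)
  have "bij_betw h (Field (linear_sum r s)) A"
    unfolding bij_betw_def
  proof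
    show "inj_on h (Field (linear_sum r s))"
    proof (rule inj_onI)
      fix u v
      assume "u \<in> Field (linear_sum r s)" "v \<in> Field (linear_sum r s)" "h u = h v"
      then show "u = v"
        using lt lt[THEN conjunct2, symmetric] unfolding Field_linear_sum h_def
        by (elim UnE imageE; auto dest: inj_onD[OF bij_betw_imp_inj_on[OF f]] inj_onD[OF bij_betw_imp_inj_on[OF g]])
    qed
    show "h ` Field (linear_sum r s) = A"
      using f g unfolding Field_linear_sum h_def bij_betw_def A
      by (simp add: image_Un image_image)
  qed
  moreover have "\<forall>x\<in>Field (linear_sum r s). \<forall>y\<in>Field (linear_sum r s).
      (x, y) \<in> linear_sum r s \<longleftrightarrow> le (h x) (h y)"
    using fr gs lt nle unfolding Field_linear_sum h_def
    by (auto simp: in_linear_sum)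
  ultimately show "copy_on le (linear_sum r s) A"
    unfolding copy_on_def by blast
qed

lemma has_induced_copy_iff_copy_on:
  "has_induced_copy (incl_poset F) r \<longleftrightarrow> (\<exists>A\<subseteq>F. copy_on (\<subseteq>) r A)"
proof -
  have mem: "(x, y) \<in> incl_poset G \<longleftrightarrow> x \<in> G \<and> y \<in> G \<and> x \<subseteq> y" for x y and G :: "'a set set"
    unfolding incl_poset_def relation_of_def by simp
  have Field_incl: "Field (incl_poset G) = G" for G :: "'a set set"
  proof (rule set_eqI)
    fix x show "x \<in> Field (incl_poset G) \<longleftrightarrow> x \<in> G"
      unfolding Field_def Un_iff Domain_iff Range_iff mem by blast
  qed
  have Restr_incl: "Restr (incl_poset F) A = incl_poset A" if "A \<subseteq> F" for A
  proof (rule set_eqI)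
    fix p :: "'a set \<times> 'a set"
    obtain x y where "p = (x, y)" by (rule prod.exhaust)
    then show "p \<in> Restr (incl_poset F) A \<longleftrightarrow> p \<in> incl_poset A"
      using subsetD[OF that] by (simp add: mem) metis
  qed
  show ?thesis
  proof
    assume "has_induced_copy (incl_poset F) r"
    then obtain f g where sub: "f ` Field r \<subseteq> F"
      and "iso (Restr (incl_poset F) (f ` Field r)) r g"
      unfolding has_induced_copy_def poset_isomorphic_def Field_incl by blast
    then have "iso (incl_poset (f ` Field r)) r g"
      using Restr_incl by simp
    then have g: "bij_betw g (f ` Field r) (Field r)"
      and gi: "\<And>x y. x \<in> f ` Field r \<Longrightarrow> y \<in> f ` Field r \<Longrightarrow> x \<subseteq> y \<longleftrightarrow> (g x, g y) \<in> r"
      unfolding iso_iff2 Field_incl by (auto simp: mem)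
    let ?h = "inv_into (f ` Field r) g"
    have h: "bij_betw ?h (Field r) (f ` Field r)"
      using g by (rule bij_betw_inv_into)
    have "(x, y) \<in> r \<longleftrightarrow> ?h x \<subseteq> ?h y" if "x \<in> Field r" "y \<in> Field r" for x y
      using gi[of "?h x" "?h y"] that h g
      by (simp add: bij_betw_apply bij_betw_inv_into_right)
    then show "\<exists>A\<subseteq>F. copy_on (\<subseteq>) r A"
      using sub h unfolding copy_on_def by blast
  next
    assume "\<exists>A\<subseteq>F. copy_on (\<subseteq>) r A"
    then obtain A f where "A \<subseteq> F" and f: "bij_betw f (Field r) A"
      and fi: "\<And>x y. x \<in> Field r \<Longrightarrow> y \<in> Field r \<Longrightarrow> (x, y) \<in> r \<longleftrightarrow> f x \<subseteq> f y"
      unfolding copy_on_def by blast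
    have A: "f ` Field r = A" using f by (simp add: bij_betw_def)
    let ?g = "inv_into (Field r) f"
    have g: "bij_betw ?g A (Field r)"
      using f by (rule bij_betw_inv_into)
    have "iso (incl_poset A) r ?g"
      unfolding iso_iff2 Field_incl
    proof (intro conjI ballI)
      fix a b assume "a \<in> A" "b \<in> A"
      then show "(a, b) \<in> incl_poset A \<longleftrightarrow> (?g a, ?g b) \<in> r"
        using fi[of "?g a" "?g b"] f g
        by (simp add: mem bij_betw_apply bij_betw_inv_into_right)
    qed (rule g)
    moreover have "\<forall>x y. (x, y) \<in> r \<longrightarrow> (f x, f y) \<in> incl_poset F"
    proof (intro allI impI)
      fix x y assume "(x, y) \<in> r"
      then have "x \<in> Field r" "y \<in> Field r" by (rule FieldI1, rule FieldI2)
      then show "(f x, f y) \<in> incl_poset F"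
        unfolding mem using fi \<open>(x, y) \<in> r\<close> \<open>A \<subseteq> F\<close> A by blast
    qed
    moreover have "inj_on f (Field r)" using f by (simp add: bij_betw_def)
    ultimately show "has_induced_copy (incl_poset F) r"
      using \<open>A \<subseteq> F\<close> unfolding has_induced_copy_def poset_isomorphic_def Field_incl
      by (metis A Restr_incl)
  qed
qed

lemma has_induced_copy_iff_has_stack:
  assumes "Field Q \<noteq> {}"
  shows "has_induced_copy (incl_poset F) (linear_sum (linear_sum P1 Q) P2) \<longleftrightarrow>
    has_stack (\<subseteq>) P1 Q P2 F"
proof
  assume "has_induced_copy (incl_poset F) (linear_sum (linear_sum P1 Q) P2)"
  then obtain A where "A \<subseteq> F" and "copy_on (\<subseteq>) (linear_sum (linear_sum P1 Q) P2) A"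
    unfolding has_induced_copy_iff_copy_on by blast
  then obtain B C2 where A: "A = B \<union> C2" and B: "copy_on (\<subseteq>) (linear_sum P1 Q) B"
    and C2: "copy_on (\<subseteq>) P2 C2" "all_below (\<subseteq>) C2 B"
    unfolding copy_on_linear_sum[OF antisymp_on_le] by blast
  obtain C1 D where B_eq: "B = C1 \<union> D" and "copy_on (\<subseteq>) P1 C1" "copy_on (\<subseteq>) Q D"
    and "all_below (\<subseteq>) D C1"
    using B unfolding copy_on_linear_sum[OF antisymp_on_le] by blast
  moreover have "all_below (\<subseteq>) C2 D"
    using C2(2) unfolding B_eq all_below_Un_right by (rule conjunct2)
  ultimately show "has_stack (\<subseteq>) P1 Q P2 F"
    using C2(1) \<open>A \<subseteq> F\<close> unfolding A by (intro has_stackI) auto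
next
  assume "has_stack (\<subseteq>) P1 Q P2 F"
  then obtain C1 D C2 where sub: "C1 \<subseteq> F" "D \<subseteq> F" "C2 \<subseteq> F"
    and copies: "copy_on (\<subseteq>) P1 C1" "copy_on (\<subseteq>) Q D" "copy_on (\<subseteq>) P2 C2"
    and below: "all_below (\<subseteq>) C2 D" "all_below (\<subseteq>) D C1"
    unfolding has_stack_def stacked_def by blast
  obtain d where "d \<in> D"
    using copies(2) assms unfolding copy_on_def bij_betw_def by blast
  then have "all_below (\<subseteq>) C2 C1"
    by (rule all_below_trans[OF transp_on_le antisymp_on_le below])
  then have "all_below (\<subseteq>) C2 (C1 \<union> D)"
    using below(1) unfolding all_below_Un_right by (rule conjI)
  moreover have "copy_on (\<subseteq>) (linear_sum P1 Q) (C1 \<union> D)"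
    by (rule copy_on_linear_sum[THEN iffD2, OF antisymp_on_le])
      (intro exI conjI, rule refl, (rule copies below)+)
  ultimately have "copy_on (\<subseteq>) (linear_sum (linear_sum P1 Q) P2) (C1 \<union> D \<union> C2)"
    using copies(3) copy_on_linear_sum[OF antisymp_on_le, of "linear_sum P1 Q" P2] by blast
  then show "has_induced_copy (incl_poset F) (linear_sum (linear_sum P1 Q) P2)"
    unfolding has_induced_copy_iff_copy_on using sub by (meson Un_least)
qed

section \<open>Elements just above a member of the family\<close>

text \<open>
  The exchange step, in a form that covers \<open>S = insert i X\<close> under inclusion and \<open>S = X - {i}\<close> under
  reverse inclusion. An element is marked (\<open>m\<close>) if it is already on the far side of the point \<open>i\<close>, and
  \<open>s X\<close> is \<open>X\<close> moved to that side. The assumptions say that, seen from \<open>F\<close>, the new element \<open>s X\<close> has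
  the same lower bounds as \<open>X\<close> and loses just the unmarked upper bounds. Choosing \<open>X\<close> maximal removes
  this last difference within the middle layer of any stack that uses \<open>s X\<close>.
\<close>

lemma no_stack_around_unmarked:
  fixes F :: "'x set" and le :: "'x \<Rightarrow> 'x \<Rightarrow> bool"
  assumes le: "reflp le" "transp le" "antisymp le"
    and "finite F" and "UCTP Q"
    and free: "\<not> has_stack le P1 Q P2 F"
    and sat: "\<And>X. X \<in> F \<Longrightarrow> \<not> m X \<Longrightarrow> s X \<notin> F \<and> has_stack le P1 Q P2 (insert (s X) F)"
    and le_s: "\<And>X. X \<in> F \<Longrightarrow> \<not> m X \<Longrightarrow> le X (s X)"
    and below_s: "\<And>X Z. X \<in> F \<Longrightarrow> \<not> m X \<Longrightarrow> Z \<in> F \<Longrightarrow> le Z (s X) \<Longrightarrow> le Z X"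
    and above_s: "\<And>X Z. X \<in> F \<Longrightarrow> \<not> m X \<Longrightarrow> Z \<in> F \<Longrightarrow> le (s X) Z \<longleftrightarrow> le X Z \<and> m Z"
    and "X0 \<in> F" "\<not> m X0"
    and "A1 \<subseteq> F" "copy_on le P1 A1" "all_below le {X0} A1" "\<forall>Z\<in>A1. m Z"
    and "A2 \<subseteq> F" "copy_on le P2 A2" "all_below le A2 {X0}"
  shows False
proof -
  have refl: "le x x" for x using le by (simp add: reflpD)
  have trans: "le x y \<Longrightarrow> le y z \<Longrightarrow> le x z" for x y z using le(2) by (rule transpD)
  have antisym: "le x y \<Longrightarrow> le y x \<Longrightarrow> x = y" for x y using le(3) by (rule antisympD)
  define G where "G = {X \<in> F. \<not> m X \<and>
      (\<exists>C\<subseteq>F. copy_on le P1 C \<and> all_below le {X} C \<and> (\<forall>Z\<in>C. m Z)) \<and>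
      (\<exists>C\<subseteq>F. copy_on le P2 C \<and> all_below le C {X})}"
  have "X0 \<in> G" using assms unfolding G_def by blast
  have "finite G" using \<open>finite F\<close> unfolding G_def by simp
  \<comment> \<open>a maximal element of \<open>G\<close>, found as one with the fewest elements of \<open>G\<close> above it\<close>
  define up where "up X = card {Z \<in> G. le X Z}" for X
  obtain X where "X \<in> G" and X_min: "\<And>Y. Y \<in> G \<Longrightarrow> up X \<le> up Y"
    using ex_has_least_nat[of "\<lambda>X. X \<in> G" X0 up] \<open>X0 \<in> G\<close> by blast
  have X_max: "Y = X" if "Y \<in> G" "le X Y" for Y
  proof (rule ccontr)
    assume "Y \<noteq> X"
    then have "{Z \<in> G. le Y Z} \<subset> {Z \<in> G. le X Z}"
      using that \<open>X \<in> G\<close> trans antisym refl by blast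
    then have "up Y < up X"
      unfolding up_def using \<open>finite G\<close> by (simp add: psubset_card_mono)
    then show False using X_min[OF \<open>Y \<in> G\<close>] by simp
  qed
  obtain C1 C2 where X: "X \<in> F" "\<not> m X"
    and C1: "C1 \<subseteq> F" "copy_on le P1 C1" "all_below le {X} C1" "\<forall>Z\<in>C1. m Z"
    and C2: "C2 \<subseteq> F" "copy_on le P2 C2" "all_below le C2 {X}"
    using \<open>X \<in> G\<close> unfolding G_def by blast
  define S where "S = s X"
  have S: "S \<notin> F" "le X S"
    using sat[OF X] le_s[OF X] unfolding S_def by auto
  have below_S: "le Z S \<longleftrightarrow> le Z X" if "Z \<in> F" for Z
    using that below_s X S trans unfolding S_def by blast
  have above_S: "le S Z \<longleftrightarrow> le X Z \<and> m Z" if "Z \<in> F" for Z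
    using that above_s X unfolding S_def by blast
  have S_C1: "all_below le {S} C1"
    using C1 above_S S unfolding all_below_def by blast
  have C2_S: "all_below le C2 {S}"
    using C2 below_S S unfolding all_below_def by blast
  have "has_stack le P1 Q P2 (insert S F)" using sat X unfolding S_def by blast
  then obtain D1 D D2 where sub: "D1 \<subseteq> insert S F" "D \<subseteq> insert S F" "D2 \<subseteq> insert S F"
    and copies: "copy_on le P1 D1" "copy_on le Q D" "copy_on le P2 D2"
    and below: "all_below le D2 D" "all_below le D D1"
    unfolding has_stack_def stacked_def by blast
  have lt_trans: "all_below le A {Y} \<Longrightarrow> all_below le {Y} B \<Longrightarrow> all_below le A B" for A B Y
    by (rule all_below_trans[OF le(2,3)]) auto
  have at: "all_below le A {Y}" if "all_below le A B" "Y \<in> B" for A B Y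
    using that unfolding all_below_def by blast
  have at': "all_below le {Y} B" if "all_below le A B" "Y \<in> A" for A B Y
    using that unfolding all_below_def by blast
  \<comment> \<open>an outer layer that contains \<open>S\<close> can be replaced by \<open>C1\<close> or \<open>C2\<close>\<close>
  have "S \<in> D"
  proof (rule ccontr)
    assume "S \<notin> D"
    then have D: "D \<subseteq> F" using sub by blast
    obtain B1 where "B1 \<subseteq> F" "copy_on le P1 B1" "all_below le D B1"
    proof (cases "S \<in> D1")
      case True
      have "all_below le D C1" using at[OF below(2) True] S_C1 by (rule lt_trans)
      with C1 show ?thesis using that by blast
    next
      case False
      then show ?thesis using that sub copies below by blast
    qed
    moreover obtain B2 where "B2 \<subseteq> F" "copy_on le P2 B2" "all_below le B2 D"
    proof (cases "S \<in> D2")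
      case True
      have "all_below le C2 D" using C2_S at'[OF below(1) True] by (rule lt_trans)
      with C2 show ?thesis using that by blast
    next
      case False
      then show ?thesis using that sub copies below by blast
    qed
    ultimately show False
      using free has_stackI copies(2) D by metis
  qed
  then have D12: "D1 \<subseteq> F" "D2 \<subseteq> F" using below sub unfolding all_below_def by blast+
  have D1_m: "\<forall>Z\<in>D1. m Z"
    using \<open>S \<in> D\<close> below D12 above_S unfolding all_below_def by blast
  have E_F: "D - {S} \<subseteq> F" using sub by blast
  have same: "(le Z S \<longleftrightarrow> le Z X) \<and> (le S Z \<longleftrightarrow> le X Z)" if "Z \<in> D - {S}" "Z \<noteq> X" for Z
  proof -
    have "Z \<in> F" using that E_F by blast
    have "m Z" if "le X Z"
    proof (rule ccontr)
      \<comment> \<open>the layers around \<open>S\<close> also surround \<open>Z\<close>, so \<open>Z\<close> would be a larger element of \<open>G\<close>\<close>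
      assume "\<not> m Z"
      then have "Z \<in> G"
        using \<open>Z \<in> F\<close> D12 D1_m copies at[OF below(1)] at'[OF below(2)] \<open>Z \<in> D - {S}\<close>
        unfolding G_def by blast
      then show False using X_max that \<open>Z \<noteq> X\<close> by blast
    qed
    then show ?thesis using below_S above_S \<open>Z \<in> F\<close> by blast
  qed
  show False
  proof (cases "X \<in> D")
    case True
    obtain Z where "Z \<in> D" "(le Z X \<or> le X Z) \<noteq> (le Z S \<or> le S Z)"
    proof (rule copy_on_UCTP[OF \<open>UCTP Q\<close> copies(2) True \<open>S \<in> D\<close> \<open>le X S\<close>])
      show "X \<noteq> S" using X S by blast
      show "Z = X \<or> Z = S" if "Z \<in> D" "le X Z" "le Z S" for Z
        using that same antisym by blast
    qed
    then show False using same refl \<open>le X S\<close> by blast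
  next
    case False
    let ?D = "insert X (D - {S})"
    have "copy_on le Q ?D"
      using le(1) copies(2) \<open>S \<in> D\<close> False same by (intro copy_on_replace) auto
    moreover have "?D \<subseteq> F" using E_F X by blast
    moreover have "all_below le ?D D1"
    proof -
      have "all_below le {X} {S}" using X S unfolding all_below_def by blast
      then have "all_below le {X} D1" using at'[OF below(2) \<open>S \<in> D\<close>] by (rule lt_trans)
      then show ?thesis using below(2) unfolding all_below_def by blast
    qed
    moreover have "\<exists>B\<subseteq>F. copy_on le P2 B \<and> all_below le B ?D"
    proof (cases "X \<in> D2")
      case True
      \<comment> \<open>\<open>X\<close> moves from the bottom layer to the middle, so that \<open>C2\<close> has to take over as bottom layer\<close>
      have "all_below le C2 (D - {S})"
        using C2(3) at'[OF below(1) True] lt_trans[of C2 X D] unfolding all_below_def by blast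
      then have "all_below le C2 ?D" using C2(3) unfolding all_below_def by blast
      then show ?thesis using C2 by blast
    next
      case False
      have "all_below le D2 {X}"
        using at[OF below(1) \<open>S \<in> D\<close>] below_S D12 False unfolding all_below_def by blast
      then have "all_below le D2 ?D" using below(1) unfolding all_below_def by blast
      then show ?thesis using D12 copies by blast
    qed
    ultimately show False
      using free has_stackI copies(1) D12(1) by metis
  qed
qed

section \<open>Two points that the family does not separate\<close>

text \<open>
  The two rounds of the argument: first a set that takes part in a middle layer, then the exchange step
  around another member of that layer.
\<close>

lemma saturated_stack_separates:
  fixes F :: "'x set set"
  assumes FN: "F \<subseteq> Pow N" "finite N"
    and "UCTP Q" "card (Field Q) \<ge> 2"
    and free: "\<not> has_stack (\<subseteq>) P1 Q P2 F"
    and sat: "\<And>S. S \<subseteq> N \<Longrightarrow> S \<notin> F \<Longrightarrow> has_stack (\<subseteq>) P1 Q P2 (insert S F)"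
    and ij: "i \<in> N" "j \<in> N" "i \<noteq> j"
    and twins: "\<And>A. A \<in> F \<Longrightarrow> i \<in> A \<longleftrightarrow> j \<in> A"
  shows False
proof -
  have "finite F" using FN by (simp add: finite_subset)
  have two: "\<exists>X\<in>D. X \<noteq> Y" if "copy_on (\<subseteq>) Q D" for D and Y :: "'x set"
  proof (rule ccontr)
    assume "\<not> (\<exists>X\<in>D. X \<noteq> Y)"
    then have "D \<subseteq> {Y}" by blast
    then have "card D \<le> 1" using card_mono[of "{Y}" D] by simp
    then show False using copy_on_card[OF that] \<open>card (Field Q) \<ge> 2\<close> by simp
  qed
  define sep where "sep S \<longleftrightarrow> S \<subseteq> N \<and> j \<in> S \<and> i \<notin> S" for S
  have sep_notin: "S \<notin> F" if "sep S" for S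
    using that twins unfolding sep_def by blast
  have middle: "\<exists>S C1 D C2. sep S \<and> S \<in> D \<and> D \<subseteq> insert S F \<and>
      C1 \<subseteq> insert S F \<and> C2 \<subseteq> insert S F \<and> stacked (\<subseteq>) P1 Q P2 C1 D C2"
  proof (rule ccontr)
    assume no_middle: "\<not> ?thesis"
    \<comment> \<open>\<open>S\<close> can be completed to a stack as part of the bottom layer only if it is \<open>low\<close>, and as part
      of the top layer only if it is \<open>high\<close>\<close>
    define low where "low S \<longleftrightarrow> (\<exists>C1 D. C1 \<subseteq> F \<and> D \<subseteq> F \<and> copy_on (\<subseteq>) P1 C1 \<and>
        copy_on (\<subseteq>) Q D \<and> all_below (\<subseteq>) D C1 \<and> all_below (\<subseteq>) {S} D)" for S
    define high where "high S \<longleftrightarrow> (\<exists>D C2. D \<subseteq> F \<and> C2 \<subseteq> F \<and> copy_on (\<subseteq>) Q D \<and>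
        copy_on (\<subseteq>) P2 C2 \<and> all_below (\<subseteq>) C2 D \<and> all_below (\<subseteq>) D {S})" for S
    have low_or_high: "low S \<or> high S" if sep: "sep S" for S
    proof -
      obtain C1 D C2 where sub: "C1 \<subseteq> insert S F" "D \<subseteq> insert S F" "C2 \<subseteq> insert S F"
        and st: "stacked (\<subseteq>) P1 Q P2 C1 D C2"
        using sat[OF _ sep_notin[OF sep]] sep unfolding has_stack_def sep_def by blast
      have copies: "copy_on (\<subseteq>) P1 C1" "copy_on (\<subseteq>) Q D" "copy_on (\<subseteq>) P2 C2"
        and below: "all_below (\<subseteq>) C2 D" "all_below (\<subseteq>) D C1"
        using st unfolding stacked_def by auto
      have "S \<notin> D" using no_middle sep sub st by blast
      then have "D \<subseteq> F" using sub by blast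
      obtain d where "d \<in> D" using two[OF copies(2)] by blast
      have "\<not> (S \<in> C1 \<and> S \<in> C2)"
        using all_belowD[OF below(1) _ \<open>d \<in> D\<close>] all_belowD[OF below(2) \<open>d \<in> D\<close>]
        by (metis subset_antisym)
      moreover have "\<not> (C1 \<subseteq> F \<and> C2 \<subseteq> F)"
        using free has_stackI[OF copies below _ \<open>D \<subseteq> F\<close>] by iprover
      then have "S \<in> C1 \<or> S \<in> C2"
        using sub(1,3) by (metis subset_insert)
      ultimately consider "S \<in> C1" "C2 \<subseteq> F" | "S \<in> C2" "C1 \<subseteq> F"
        using sub(1,3) by (metis subset_insert)
      then show ?thesis
      proof cases
        case 1
        then have "high S"
          unfolding high_def using copies below(1) \<open>D \<subseteq> F\<close>
            all_below_mono[OF below(2) subset_refl, of "{S}"] by blast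
        then show ?thesis ..
      next
        case 2
        then have "low S"
          unfolding low_def using copies below(2) \<open>D \<subseteq> F\<close>
            all_below_mono[OF below(1) _ subset_refl, of "{S}"] by blast
        then show ?thesis ..
      qed
    qed
    \<comment> \<open>only the empty set lies strictly below \<open>{j}\<close>, but a copy of \<open>Q\<close> has two members\<close>
    have "\<not> high {j}"
    proof
      assume "high {j}"
      then obtain D where D: "copy_on (\<subseteq>) Q D" "all_below (\<subseteq>) D {{j}}"
        unfolding high_def by blast
      then obtain X where "X \<in> D" "X \<noteq> {}" using two by blast
      then show False using all_belowD[OF D(2), of X "{j}"] by blast
    qed
    moreover have "sep {j}" using ij unfolding sep_def by blast
    ultimately have "{j} \<in> {S. sep S \<and> low S}" using low_or_high by blast
    moreover have "finite {S. sep S \<and> low S}"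
      by (rule finite_subset[of _ "Pow N"]) (auto simp: sep_def \<open>finite N\<close>)
    ultimately obtain S where S: "sep S" "low S"
      and S_max: "\<And>Y. sep Y \<Longrightarrow> low Y \<Longrightarrow> S \<subseteq> Y \<Longrightarrow> S = Y"
      using finite_has_maximal[of "{S. sep S \<and> low S}"] by blast
    obtain C1 D where C1: "C1 \<subseteq> F" "copy_on (\<subseteq>) P1 C1" and D: "D \<subseteq> F" "copy_on (\<subseteq>) Q D"
      and below: "all_below (\<subseteq>) D C1" "all_below (\<subseteq>) {S} D"
      using S(2) unfolding low_def by blast
    obtain X where "X \<in> D" "X \<noteq> insert i S" using two D(2) by blast
    then have "S \<subseteq> X" "X \<in> F" using all_belowD(1)[OF below(2)] D(1) by blast+
    then have "i \<in> X" using S(1) twins unfolding sep_def by blast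
    have sepX: "sep (X - {i})"
      using \<open>S \<subseteq> X\<close> \<open>X \<in> F\<close> FN S(1) unfolding sep_def by blast
    have "S \<subseteq> X - {i}" "S \<noteq> X - {i}"
      using S(1) \<open>S \<subseteq> X\<close> \<open>i \<in> X\<close> \<open>X \<noteq> insert i S\<close> unfolding sep_def by blast+
    then have "high (X - {i})" using S_max sepX low_or_high by blast
    then obtain E C2 where E: "E \<subseteq> F" "copy_on (\<subseteq>) Q E" and C2: "C2 \<subseteq> F" "copy_on (\<subseteq>) P2 C2"
      and below': "all_below (\<subseteq>) C2 E" "all_below (\<subseteq>) E {X - {i}}"
      unfolding high_def by blast
    have "all_below (\<subseteq>) E C1"
      unfolding all_below_def
    proof (intro ballI)
      fix e c assume "e \<in> E" "c \<in> C1"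
      then have "e \<subseteq> X - {i}" "X \<subseteq> c"
        using all_belowD(1)[OF below(1) \<open>X \<in> D\<close>] all_belowD(1)[OF below'(2)] by simp_all
      then show "e \<subseteq> c \<and> e \<noteq> c" using \<open>i \<in> X\<close> by blast
    qed
    then show False
      using free has_stackI[OF C1(2) E(2) C2(2) below'(1)] C1 E C2 by blast
  qed
  then obtain S C1 D C2 where "sep S" "S \<in> D"
    and sub: "D \<subseteq> insert S F" "C1 \<subseteq> insert S F" "C2 \<subseteq> insert S F"
    and "stacked (\<subseteq>) P1 Q P2 C1 D C2"
    by (elim exE conjE)
  then have copies: "copy_on (\<subseteq>) P1 C1" "copy_on (\<subseteq>) Q D" "copy_on (\<subseteq>) P2 C2"
    and below: "all_below (\<subseteq>) C2 D" "all_below (\<subseteq>) D C1"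
    unfolding stacked_def by simp_all
  have C12: "C1 \<subseteq> F" "C2 \<subseteq> F"
    using sub all_belowD(2)[OF below(1) _ \<open>S \<in> D\<close>] all_belowD(2)[OF below(2) \<open>S \<in> D\<close>] by blast+
  have C1_i: "\<forall>Z\<in>C1. i \<in> Z" and C2_i: "\<forall>Z\<in>C2. i \<notin> Z"
    using all_belowD(1)[OF below(1) _ \<open>S \<in> D\<close>] all_belowD(1)[OF below(2) \<open>S \<in> D\<close>]
      \<open>sep S\<close> twins C12 unfolding sep_def by blast+
  obtain X where "X \<in> D" "X \<noteq> S" using two copies(2) by blast
  then have "X \<in> F" using sub by blast
  have around: "all_below (\<subseteq>) C2 {X}" "all_below (\<subseteq>) {X} C1"
    using all_below_mono[OF below(1) subset_refl, of "{X}"]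
      all_below_mono[OF below(2) _ subset_refl, of "{X}"] \<open>X \<in> D\<close> by simp_all
  show False
  proof (cases "i \<in> X")
    case False
    show False
    proof (rule no_stack_around_unmarked[where m = "\<lambda>Y. i \<in> Y" and s = "insert i",
            OF reflp_on_le transp_on_le antisymp_on_le \<open>finite F\<close> \<open>UCTP Q\<close> free _ _ _ _
              \<open>X \<in> F\<close> False C12(1) copies(1) around(2) C1_i C12(2) copies(3) around(1)])
      fix Y assume Y: "Y \<in> F" "i \<notin> Y"
      then have "insert i Y \<notin> F" using twins[OF Y(1)] twins[of "insert i Y"] \<open>i \<noteq> j\<close>
        by (metis insert_iff)
      moreover have "insert i Y \<subseteq> N" using Y(1) FN(1) \<open>i \<in> N\<close> by blast
      ultimately show "insert i Y \<notin> F \<and> has_stack (\<subseteq>) P1 Q P2 (insert (insert i Y) F)"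
        using sat by simp
      show "Y \<subseteq> insert i Y" by (rule subset_insertI)
      fix Z assume "Z \<in> F"
      show "insert i Y \<subseteq> Z \<longleftrightarrow> Y \<subseteq> Z \<and> i \<in> Z" by simp metis
      assume "Z \<subseteq> insert i Y"
      moreover have "i \<notin> Z"
        using \<open>Z \<subseteq> insert i Y\<close> twins[OF \<open>Z \<in> F\<close>] twins[OF Y(1)] Y(2) \<open>i \<noteq> j\<close> by auto
      ultimately show "Z \<subseteq> Y" by (simp add: subset_insert)
    qed
  next
    case True
    have dual: "UCTP (Q\<inverse>)" "\<not> has_stack (\<lambda>x y. y \<subseteq> x) (P2\<inverse>) (Q\<inverse>) (P1\<inverse>) F"
      "copy_on (\<lambda>x y. y \<subseteq> x) (P1\<inverse>) C1" "copy_on (\<lambda>x y. y \<subseteq> x) (P2\<inverse>) C2"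
      "all_below (\<lambda>x y. y \<subseteq> x) {X} C2" "all_below (\<lambda>x y. y \<subseteq> x) C1 {X}"
      unfolding UCTP_converse has_stack_converse[of "(\<subseteq>)"] copy_on_converse[of "(\<subseteq>)"]
        all_below_converse[of "(\<subseteq>)"]
      by (fact \<open>UCTP Q\<close> free copies around)+
    have "\<not> i \<notin> X" using True by simp
    show False
    proof (rule no_stack_around_unmarked[where le = "\<lambda>x y. y \<subseteq> x" and m = "\<lambda>Y. i \<notin> Y"
            and s = "\<lambda>Y. Y - {i}",
            OF reflp_on_ge transp_on_ge antisymp_on_ge \<open>finite F\<close> dual(1,2) _ _ _ _
              \<open>X \<in> F\<close> \<open>\<not> i \<notin> X\<close> C12(2) dual(4,5) C2_i C12(1) dual(3,6)])
      fix Y assume Y: "Y \<in> F" "\<not> i \<notin> Y"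
      then have "Y - {i} \<notin> F" using twins[OF Y(1)] twins[of "Y - {i}"] \<open>i \<noteq> j\<close>
        by (metis Diff_iff singleton_iff)
      moreover have "Y - {i} \<subseteq> N" using Y(1) FN(1) by blast
      ultimately show "Y - {i} \<notin> F \<and>
          has_stack (\<lambda>x y. y \<subseteq> x) (P2\<inverse>) (Q\<inverse>) (P1\<inverse>) (insert (Y - {i}) F)"
        unfolding has_stack_converse[of "(\<subseteq>)"] using sat by simp
      show "Y - {i} \<subseteq> Y" by (rule Diff_subset)
      fix Z assume "Z \<in> F"
      show "Z \<subseteq> Y - {i} \<longleftrightarrow> Z \<subseteq> Y \<and> i \<notin> Z" by (rule subset_Diff_insert[of Z Y i "{}", simplified])
      assume "Y - {i} \<subseteq> Z"
      moreover have "i \<in> Z"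
        using \<open>Y - {i} \<subseteq> Z\<close> twins[OF \<open>Z \<in> F\<close>] twins[OF Y(1)] Y(2) \<open>i \<noteq> j\<close> by auto
      ultimately show "Y \<subseteq> Z" by auto
    qed
  qed
qed

section \<open>Bounds on the saturation number\<close>

text \<open>
  There are only \<open>2 ^ card F\<close> possible traces \<open>{A \<in> F. i \<in> A}\<close>; if \<open>n\<close> exceeds this number, two points
  share their trace.
\<close>

lemma saturated_card_ge:
  assumes "UCTP Q" "card (Field Q) \<ge> 2"
    and "saturated n (linear_sum (linear_sum P1 Q) P2) F"
  shows "n \<le> 2 ^ card F"
proof (rule ccontr)
  assume "\<not> ?thesis"
  have F: "F \<subseteq> Pow {1..n}" using assms(3) unfolding saturated_def by blast
  have "finite F" by (rule finite_subset[OF F]) simp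
  have "Field Q \<noteq> {}" using assms(2) by auto
  note stack = has_induced_copy_iff_has_stack[OF this]
  let ?trace = "\<lambda>i. {A \<in> F. i \<in> A}"
  have "card (?trace ` {1..n}) \<le> card (Pow F)"
    by (rule card_mono) (auto simp: \<open>finite F\<close>)
  then have "\<not> inj_on ?trace {1..n}"
    using \<open>\<not> n \<le> 2 ^ card F\<close> \<open>finite F\<close> card_image[of ?trace "{1..n}"] by (auto simp: card_Pow)
  then obtain i j where "i \<in> {1..n}" "j \<in> {1..n}" "i \<noteq> j" "?trace i = ?trace j"
    unfolding inj_on_def by blast
  moreover have "\<not> has_stack (\<subseteq>) P1 Q P2 F"
    "\<And>S. S \<subseteq> {1..n} \<Longrightarrow> S \<notin> F \<Longrightarrow> has_stack (\<subseteq>) P1 Q P2 (insert S F)"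
    using assms(3) unfolding saturated_def stack by auto
  ultimately show False
    using saturated_stack_separates[OF F _ assms(1,2), of P1 P2 i j] by blast
qed

text \<open>
  A maximal family without a copy is saturated. This is needed because \<^const>\<open>sat_star\<close> is a
  \<open>LEAST\<close>, which says nothing about saturated families unless there is one.
\<close>

lemma saturated_exists:
  assumes "Field r \<noteq> {}"
  shows "\<exists>F. saturated n r F"
proof -
  let ?free = "{F. F \<subseteq> Pow {1..n} \<and> \<not> has_induced_copy (incl_poset F) r}"
  have "\<not> has_induced_copy (incl_poset {}) r"
    using assms by (simp add: has_induced_copy_iff_copy_on copy_on_def bij_betw_def)
  then have "{} \<in> ?free" by simp
  moreover have "finite ?free" by simp
  ultimately obtain F where F: "F \<in> ?free" and F_max: "\<And>G. G \<in> ?free \<Longrightarrow> F \<subseteq> G \<Longrightarrow> F = G"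
    using finite_has_maximal[of ?free] by (metis (no_types, lifting) empty_iff)
  have "has_induced_copy (incl_poset (F \<union> {S})) r" if "S \<subseteq> {1..n}" "S \<notin> F" for S
  proof (rule ccontr)
    assume "\<not> ?thesis"
    then have "F \<union> {S} \<in> ?free" using F that by simp
    then have "F = F \<union> {S}" by (rule F_max[OF _ Un_upper1])
    then show False using \<open>S \<notin> F\<close> by (metis UnI2 singletonI)
  qed
  then have "saturated n r F"
    using F unfolding saturated_def by simp
  then show ?thesis ..
qed

theorem theorem16:
  fixes P1 :: "'a rel" and Q :: "'b rel" and P2 :: "'c rel"
  assumes "Partial_order P1" and "finite (Field P1)"
    and "Partial_order P2" and "finite (Field P2)"
    and "Partial_order Q" and "finite (Field Q)"
    and "UCTP Q" and "card (Field Q) \<ge> 2"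
  shows "filterlim (\<lambda>n. sat_star n (linear_sum (linear_sum P1 Q) P2)) at_top sequentially"
proof -
  let ?P = "linear_sum (linear_sum P1 Q) P2"
  have "Field Q \<noteq> {}" using assms(8) by auto
  then have nonempty: "Field ?P \<noteq> {}" by (simp add: Field_linear_sum)
  have bound: "n \<le> 2 ^ sat_star n ?P" for n
  proof -
    obtain F where "saturated n ?P F"
      using saturated_exists[OF nonempty] by (rule exE)
    then have "\<exists>k F. saturated n ?P F \<and> card F = k" by (intro exI conjI) (assumption, rule refl)
    then have "\<exists>F. saturated n ?P F \<and> card F = sat_star n ?P"
      unfolding sat_star_def by (rule LeastI_ex)
    then obtain F where "saturated n ?P F" "card F = sat_star n ?P" by (elim exE conjE)
    then show ?thesis using saturated_card_ge[OF assms(7,8), of n P1 P2 F] by simp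
  qed
  show ?thesis
    unfolding filterlim_at_top
  proof
    fix K :: nat
    show "\<forall>\<^sub>F n in sequentially. K \<le> sat_star n ?P"
    proof (rule eventually_sequentiallyI[of "2 ^ K"])
      fix n :: nat assume "2 ^ K \<le> n"
      also have "n \<le> 2 ^ sat_star n ?P" by (rule bound)
      finally show "K \<le> sat_star n ?P" by simp
    qed
  qed
qed

end
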